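(* Let $\mathcal{A}=\{H_1,\dots,H_m\}$ be a finite central real hyperplane arrangement in $\mathbb{R}^d$ of rank $r$. Then for each $k$, the sum $\sum_{\mathcal{C}} \nu_k(\mathcal{C})$, taken over the closures $\mathcal{C}$ of all regions of $\mathcal{A}$, equals the absolute value of the coefficient of $t^{r-d+k}$ in the characteristic polynomial $\chi_{\mathcal{A}}(t)$.
   Context: A finite real hyperplane arrangement $\mathcal{A}=\{H_1,\dots,H_m\}$ in $\mathbb{R}^d$ is central if every hyperplane passes through the origin, i.e. $H_i=\{z:\eta_i\cdot z=0\}$ with $\eta_i\neq 0$. Its rank is $r=\dim \mathrm{Span}\{\eta_1,\dots,\eta_m\}$. A region is a connected component of $\mathbb{R}^d\setminus\bigcup_i H_i$; for a central arrangement the closure of a region is a polyhedral cone. The intersection lattice $L(\mathcal{A})$ is the set of all intersections of subcollections of hyperplanes (including $\mathbb{R}^d$ as the empty intersection), ordered by reverse inclusion; its minimum is $\hat 0=\mathbb{R}^d$, the rank of $x$ is $d-\dim x$, and the lattice has rank $r$. With $\mu$ the Möbius function of $L(\mathcal{A})$ and $\mu(x)=\mu(\hat 0,x)$, the characteristic polynomial is $\chi_{\mathcal{A}}(t)=\sum_{x\in L(\mathcal{A})}\mu(x)\,t^{\,r-(d-\dim x)}$. Projection volumes: for a polyhedral cone $\mathcal{C}\subseteq\mathbb{R}^d$ and $z\in\mathbb{R}^d$, let $\pi_{\mathcal{C}}(z)$ be the orthogonal (nearest-point) projection of $z$ onto $\mathcal{C}$. For a face $F$ of $\mathcal{C}$,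 let $X_F$ be the cone of points $z$ with $\pi_{\mathcal{C}}(z)$ in the relative interior of $F$, and let $\nu(F)=|X_F\cap S^{d-1}|/|S^{d-1}|$ (normalized spherical measure, equivalently $|X_F\cap B^d|/|B^d|$). Then $\nu_k(\mathcal{C})=\sum_{F}\nu(F)$ over all $k$-dimensional faces $F$ of $\mathcal{C}$. *)

theory Defs
  imports "HOL-Analysis.Analysis" "HOL-Computational_Algebra.Polynomial"
begin

definition central_hyperplane :: "'a::euclidean_space \<Rightarrow> 'a set" where
  "central_hyperplane \<eta> = {z. \<eta> \<bullet> z = 0}"

definition regions :: "'a::euclidean_space set set \<Rightarrow> 'a set set" where
  "regions \<A> = components (UNIV - \<Union>\<A>)"

text \<open>The empty subcollection contributes the whole space, since \<^term>\<open>\<Inter>{} = UNIV\<close>.\<close>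

definition intersection_lattice :: "'a::euclidean_space set set \<Rightarrow> 'a set set" where
  "intersection_lattice \<A> = {\<Inter>\<B> | \<B>. \<B> \<subseteq> \<A>}"

text \<open>The Moebius function of a finite family \<open>L\<close> of sets ordered by reverse inclusion
  (\<open>x\<close> is below \<open>y\<close> iff \<open>y \<subseteq> x\<close>), given by \<open>\<mu>(x,x) = 1\<close> and
  \<open>\<mu>(x,y) = - (\<Sum>x \<le> z < y. \<mu>(x,z))\<close> for \<open>x < y\<close>; it is \<open>0\<close> on all other arguments.\<close>

function moebius :: "'a set set \<Rightarrow> 'a set \<Rightarrow> 'a set \<Rightarrow> int" where
  "moebius L x y =
     (if finite L \<and> x \<in> L \<and> y \<in> L then
        if x = y then 1
        else if y \<subset> x then - (\<Sum>z\<in>{z\<in>L. z \<subseteq> x \<and> y \<subset> z}. moebius L x z)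
        else 0
      else 0)"
  by pat_completeness auto
termination
proof (relation "Wellfounded.measure (\<lambda>(L, x, y). card {z\<in>L. y \<subset> z})", goal_cases)
  case (2 L x y z)
  then have "{w\<in>L. z \<subset> w} \<subset> {w\<in>L. y \<subset> w}" by blast
  with 2 show ?case by (auto intro!: psubset_card_mono)
qed simp

declare moebius.simps [simp del]

text \<open>The parameter \<open>r\<close> is the rank of the arrangement. For \<open>x\<close> in the intersection lattice,
  \<open>d - dim x \<le> r\<close>, so that the truncated subtractions in the exponent are exact.\<close>

definition characteristic_polynomial :: "nat \<Rightarrow> 'a::euclidean_space set set \<Rightarrow> int poly" where
  "characteristic_polynomial r \<A> =
     (\<Sum>x\<in>intersection_lattice \<A>.
        monom (moebius (intersection_lattice \<A>) UNIV x) (r - (DIM('a) - dim x)))"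

text \<open>The coefficient of a possibly negative power of the variable.\<close>

definition int_coeff :: "'b::zero poly \<Rightarrow> int \<Rightarrow> 'b" where
  "int_coeff p n = (if n \<ge> 0 then coeff p (nat n) else 0)"

definition projection_cone :: "'a::euclidean_space set \<Rightarrow> 'a set \<Rightarrow> 'a set" where
  "projection_cone C F = {z. closest_point C z \<in> rel_interior F}"

text \<open>The projection cone is a cone, so its normalized spherical measure is the fraction of the
  unit ball that it fills.\<close>

definition face_volume :: "'a::euclidean_space set \<Rightarrow> 'a set \<Rightarrow> real" where
  "face_volume C F =
     measure lebesgue (projection_cone C F \<inter> cball 0 1) / measure lebesgue (cball (0::'a) 1)"

text \<open>The affine dimension excludes the empty set, which counts as a face in the library
  but has \<^term>\<open>aff_dim {} = -1\<close> (whereas \<^term>\<open>dim {} = 0\<close>).\<close>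

definition projection_volume :: "nat \<Rightarrow> 'a::euclidean_space set \<Rightarrow> real" where
  "projection_volume k C = (\<Sum>F\<in>{F. F face_of C \<and> aff_dim F = int k}. face_volume C F)"

end

theory Submission
  imports Defs
begin

text \<open>The sum of the projection volumes is the average over the unit ball of the number of pairs
  \<open>(C, F)\<close> with \<open>z\<close> projecting into the relative interior of the \<open>k\<close>-dimensional face \<open>F\<close> of \<open>C\<close>,
  and this number is the same for almost every \<open>z\<close>. If \<open>X\<close> is the flat spanned by \<open>F\<close>, then the
  projection of \<open>z\<close> to \<open>C\<close> is the orthogonal projection \<open>p\<close> of \<open>z\<close> to \<open>X\<close>. Near \<open>p\<close> only the
  hyperplanes through \<open>X\<close> are visible, so the regions \<open>C\<close> that contribute to \<open>X\<close> are the regions of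
  the localization at \<open>X\<close> that lie in the halfspace \<open>w \<bullet> x \<le> 0\<close> for \<open>w = z - p\<close>. The number of
  regions in such a halfspace satisfies a deletion-restriction recurrence for every \<open>w\<close>, hence
  equals the sum of \<open>(-1)^|J| (-1)^codim\<close> over the subarrangements \<open>J\<close> whose intersection is
  orthogonal to \<open>w\<close>. For generic \<open>z\<close> these are the \<open>J\<close> with intersection \<open>X\<close>, and by
  Whitney's formula the sum is \<open>(-1)^codim \<mu>(X)\<close>.\<close>

section \<open>Sign cells, flats and perturbation into a cell\<close>

text \<open>\<open>P\<close> is the set of indices with positive sign. Keeping the ambient subspace \<open>U\<close> as a
  parameter makes restriction to a hyperplane a change of \<open>U\<close> only.\<close>

definition cell :: "('i \<Rightarrow> 'a::euclidean_space) \<Rightarrow> 'a set \<Rightarrow> 'i set \<Rightarrow> 'i set \<Rightarrow> 'a set" where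
  "cell \<eta> U I P = {x\<in>U. (\<forall>i\<in>P. 0 < \<eta> i \<bullet> x) \<and> (\<forall>i\<in>I - P. \<eta> i \<bullet> x < 0)}"

definition closed_cell :: "('i \<Rightarrow> 'a::euclidean_space) \<Rightarrow> 'i set \<Rightarrow> 'i set \<Rightarrow> 'a set" where
  "closed_cell \<eta> I P = {x. (\<forall>i\<in>P. 0 \<le> \<eta> i \<bullet> x) \<and> (\<forall>i\<in>I - P. \<eta> i \<bullet> x \<le> 0)}"

definition flat :: "('i \<Rightarrow> 'a::euclidean_space) \<Rightarrow> 'i set \<Rightarrow> 'a set" where
  "flat \<eta> J = {x. \<forall>i\<in>J. \<eta> i \<bullet> x = 0}"

text \<open>The point \<open>w\<close> lies in the polar cone of \<open>S\<close>. Nonemptiness is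
  built in so that sums over all sign sets count only those realised by some point.\<close>

definition in_polar :: "'a::euclidean_space \<Rightarrow> 'a set \<Rightarrow> bool" where
  "in_polar w S \<longleftrightarrow> S \<noteq> {} \<and> (\<forall>x\<in>S. w \<bullet> x \<le> 0)"

lemma subspace_flat: "subspace (flat \<eta> J)"
  by (auto simp: flat_def subspace_def inner_add_right)

lemma flat_empty [simp]: "flat \<eta> {} = UNIV"
  by (simp add: flat_def)

lemma flat_insert: "flat \<eta> (insert j J) = {x. \<eta> j \<bullet> x = 0} \<inter> flat \<eta> J"
  by (auto simp: flat_def)

lemma convex_cell:
  assumes "subspace U"
  shows "convex (cell \<eta> U I P)"
proof -
  have "cell \<eta> U I P = U \<inter> (\<Inter>i\<in>P. {x. \<eta> i \<bullet> x > 0}) \<inter> (\<Inter>i\<in>I - P. {x. \<eta> i \<bullet> x < 0})"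
    by (auto simp: cell_def)
  then show ?thesis
    using subspace_imp_convex[OF assms]
    by (auto intro!: convex_Int convex_INT convex_halfspace_lt convex_halfspace_gt)
qed

lemma open_cell:
  assumes "finite I" "P \<subseteq> I"
  shows "open (cell \<eta> UNIV I P)"
proof -
  have "cell \<eta> UNIV I P = (\<Inter>i\<in>P. {x. \<eta> i \<bullet> x > 0}) \<inter> (\<Inter>i\<in>I - P. {x. \<eta> i \<bullet> x < 0})"
    by (auto simp: cell_def)
  moreover have "finite P" using assms finite_subset by blast
  ultimately show ?thesis
    using assms by (auto intro!: open_Int open_INT open_halfspace_lt open_halfspace_gt)
qed

lemma polyhedron_closed_cell:
  assumes "finite I" "P \<subseteq> I"
  shows "polyhedron (closed_cell \<eta> I P)"
proof -
  have "closed_cell \<eta> I P = \<Inter>((\<lambda>i. {x. \<eta> i \<bullet> x \<ge> 0}) ` P \<union> (\<lambda>i. {x. \<eta> i \<bullet> x \<le> 0}) ` (I - P))"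
    by (auto simp: closed_cell_def)
  moreover have "finite P" using assms finite_subset by blast
  ultimately show ?thesis
    using assms by (auto intro!: polyhedron_Inter polyhedron_halfspace_le polyhedron_halfspace_ge)
qed

text \<open>For small \<open>t\<close> the sign of \<open>a + t * b\<close> is decided by
  \<open>a\<close>, and by \<open>b\<close> only if \<open>a\<close> vanishes.\<close>

lemma eventually_lex_pos:
  fixes a b :: real
  assumes "0 < a \<or> (0 \<le> a \<and> 0 < b)"
  shows "\<forall>\<^sub>F t in at_right 0. 0 < a + t * b"
proof (cases "0 < a")
  case True
  have "((\<lambda>t. a + t * b) \<longlongrightarrow> a + 0 * b) (at_right 0)"
    by (intro tendsto_intros)
  then show ?thesis using True by (auto elim: order_tendstoD)
next
  case False
  have "\<forall>\<^sub>F t in at_right (0::real). 0 < t"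
    by (rule eventually_at_right_less)
  then show ?thesis
    by eventually_elim (use False assms in \<open>auto intro!: add_nonneg_pos\<close>)
qed

text \<open>Linear forms that are nonzero at \<open>p\<close> keep their sign under a small move,
  and those that vanish at \<open>p\<close> take the sign they have at \<open>v\<close>. All later
  local arguments, such as leaving a wall or comparing a cell with its localization near a point,
  are instances of this.\<close>

lemma eventually_in_cell:
  assumes "finite I" "P \<subseteq> I" "subspace U" "p \<in> U" "v \<in> U"
    and pos: "\<And>i. i \<in> P \<Longrightarrow> 0 < \<eta> i \<bullet> p \<or> (0 \<le> \<eta> i \<bullet> p \<and> 0 < \<eta> i \<bullet> v)"
    and neg: "\<And>i. i \<in> I - P \<Longrightarrow> \<eta> i \<bullet> p < 0 \<or> (\<eta> i \<bullet> p \<le> 0 \<and> \<eta> i \<bullet> v < 0)"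
  shows "\<forall>\<^sub>F t in at_right 0. p + t *\<^sub>R v \<in> cell \<eta> U I P"
proof -
  have fin: "finite P" "finite (I - P)"
    using assms finite_subset by blast+
  have "\<forall>\<^sub>F t in at_right 0. \<forall>i\<in>P. 0 < \<eta> i \<bullet> p + t * (\<eta> i \<bullet> v)"
    using fin pos by (intro eventually_ball_finite ballI eventually_lex_pos) auto
  moreover have "\<forall>\<^sub>F t in at_right 0. \<forall>i\<in>I - P. 0 < - (\<eta> i \<bullet> p) + t * (- (\<eta> i \<bullet> v))"
    using fin neg by (intro eventually_ball_finite ballI eventually_lex_pos) auto
  ultimately show ?thesis
  proof eventually_elim
    case (elim t)
    have "p + t *\<^sub>R v \<in> U"
      using assms by (simp add: subspace_add subspace_scale)
    with elim show ?case
      by (force simp: cell_def inner_add_right)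
  qed
qed

text \<open>Adding a small multiple of a point of the open cell turns every weak inequality into a
  strict one. The open cell must be nonempty, since the closed cell always contains the
  origin.\<close>

lemma closure_cell:
  assumes "finite I" "P \<subseteq> I" "cell \<eta> UNIV I P \<noteq> {}"
  shows "closure (cell \<eta> UNIV I P) = closed_cell \<eta> I P"
proof
  show "closure (cell \<eta> UNIV I P) \<subseteq> closed_cell \<eta> I P"
    using polyhedron_closed_cell[OF assms(1,2)]
    by (intro closure_minimal polyhedron_imp_closed)
      (auto simp: cell_def closed_cell_def intro: less_imp_le)
  show "closed_cell \<eta> I P \<subseteq> closure (cell \<eta> UNIV I P)"
  proof
    fix c assume c: "c \<in> closed_cell \<eta> I P"
    obtain x where x: "x \<in> cell \<eta> UNIV I P" using assms by blast
    have "\<forall>\<^sub>F t in at_right 0. c + t *\<^sub>R x \<in> cell \<eta> UNIV I P"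
      using assms c x by (intro eventually_in_cell) (auto simp: cell_def closed_cell_def)
    then have "\<forall>\<^sub>F t in at_right 0. c + t *\<^sub>R x \<in> closure (cell \<eta> UNIV I P)"
      by eventually_elim (use closure_subset in blast)
    moreover have "((\<lambda>t. c + t *\<^sub>R x) \<longlongrightarrow> c + 0 *\<^sub>R x) (at_right 0)"
      by (intro tendsto_intros)
    ultimately show "c \<in> closure (cell \<eta> UNIV I P)"
      using Lim_in_closed_set[OF closed_closure] by force
  qed
qed

section \<open>Deletion-restriction for cells in a halfspace\<close>

lemma sum_Pow_insert:
  fixes f :: "'i set \<Rightarrow> 'b::comm_monoid_add"
  assumes "finite I" "j \<notin> I"
  shows "sum f (Pow (insert j I)) = (\<Sum>P\<in>Pow I. f P + f (insert j P))"
proof -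
  have inj: "inj_on (insert j) (Pow I)"
    using assms by (auto simp: inj_on_def)
  have "sum f (Pow (insert j I)) = sum f (Pow I) + sum f (insert j ` Pow I)"
    unfolding Pow_insert using assms by (intro sum.union_disjoint) auto
  then show ?thesis
    by (simp add: sum.reindex[OF inj] sum.distrib)
qed

lemma cell_insert_neg:
  assumes "P \<subseteq> I" "j \<notin> I"
  shows "cell \<eta> U (insert j I) P = {x\<in>cell \<eta> U I P. \<eta> j \<bullet> x < 0}"
  using assms by (auto simp: cell_def)

lemma cell_insert_pos:
  assumes "P \<subseteq> I" "j \<notin> I"
  shows "cell \<eta> U (insert j I) (insert j P) = {x\<in>cell \<eta> U I P. \<eta> j \<bullet> x > 0}"
proof -
  have "insert j I - insert j P = I - P" using assms by auto
  then show ?thesis by (auto simp: cell_def)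
qed

lemma cell_Int_hyperplane: "cell \<eta> (U \<inter> {x. \<eta> j \<bullet> x = 0}) I P = {x\<in>cell \<eta> U I P. \<eta> j \<bullet> x = 0}"
  by (auto simp: cell_def)

lemma convex_crosses_hyperplane:
  assumes "convex R" "x \<in> R" "y \<in> R" "a \<bullet> x < 0" "0 < a \<bullet> y"
  obtains s where "0 < s" "s < 1" "(1 - s) *\<^sub>R x + s *\<^sub>R y \<in> R" "a \<bullet> ((1 - s) *\<^sub>R x + s *\<^sub>R y) = 0"
proof -
  \<comment> \<open>The zero of the affine function \<open>a \<bullet> _\<close> along the segment
    from \<open>x\<close> to \<open>y\<close>.\<close>
  define s where "s = - (a \<bullet> x) / (a \<bullet> y - a \<bullet> x)"
  have s: "0 < s" "s < 1" "1 - s > 0" using assms by (auto simp: s_def field_simps)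
  have "s * (a \<bullet> y - a \<bullet> x) = - (a \<bullet> x)" using assms by (simp add: s_def)
  then have "a \<bullet> ((1 - s) *\<^sub>R x + s *\<^sub>R y) = 0"
    by (simp add: inner_add_right algebra_simps)
  moreover have "(1 - s) *\<^sub>R x + s *\<^sub>R y \<in> R"
    using assms s by (intro convexD) auto
  ultimately show thesis using that s by blast
qed

text \<open>The new hyperplane cuts the old cell \<open>R\<close> into two sides and a wall. If the
  wall is empty, then by convexity so is one side, and nothing changes. Otherwise both sides are
  nonempty. A wall point with \<open>w \<bullet> x > 0\<close> has such points near it on both
  sides, so all four terms vanish. If the wall has no such point, the two sides cannot both have
  one, as the segment between them would cross the wall at a third. Then at least one side is
  counted, and \<open>R\<close> is counted exactly if both are.\<close>

lemma in_polar_deletion_restriction: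
  assumes I: "finite I" "P \<subseteq> I" "j \<notin> I" and U: "subspace U" "\<not> U \<subseteq> {x. \<eta> j \<bullet> x = 0}"
  shows "(of_bool (in_polar w (cell \<eta> U (insert j I) P)) :: int)
      + of_bool (in_polar w (cell \<eta> U (insert j I) (insert j P)))
    = of_bool (in_polar w (cell \<eta> U I P))
      + of_bool (in_polar w (cell \<eta> (U \<inter> {x. \<eta> j \<bullet> x = 0}) I P))"
proof -
  define R where "R = cell \<eta> U I P"
  define Rneg Rpos Rzero where "Rneg = {x\<in>R. \<eta> j \<bullet> x < 0}" "Rpos = {x\<in>R. \<eta> j \<bullet> x > 0}"
    "Rzero = {x\<in>R. \<eta> j \<bullet> x = 0}"
  note defs = this
  have R: "convex R" unfolding R_def by (rule convex_cell[OF U(1)])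
  have R_Un: "R = Rneg \<union> Rpos \<union> Rzero" by (auto simp: defs)
  obtain u where "u \<in> U" "\<eta> j \<bullet> u \<noteq> 0" using U by blast
  then obtain v where v: "v \<in> U" "\<eta> j \<bullet> v > 0"
    using U(1) by (cases "\<eta> j \<bullet> u > 0") (auto intro: that[of "- u"] simp: subspace_neg)
  \<comment> \<open>A wall point can be pushed along \<open>v\<close> or \<open>- v\<close> into
    either side without losing \<open>w \<bullet> x > 0\<close>.\<close>
  have near: "\<exists>y\<in>Rneg. w \<bullet> x > 0 \<longrightarrow> w \<bullet> y > 0" "\<exists>y\<in>Rpos. w \<bullet> x > 0 \<longrightarrow> w \<bullet> y > 0"
    if x: "x \<in> Rzero" for x
  proof -
    have *: "\<exists>t>0. x + t *\<^sub>R v' \<in> R \<and> (w \<bullet> x > 0 \<longrightarrow> w \<bullet> (x + t *\<^sub>R v') > 0)" if "v' \<in> U" for v'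
    proof -
      have "\<forall>\<^sub>F t in at_right 0. x + t *\<^sub>R v' \<in> R"
        unfolding R_def using x I U that
        by (intro eventually_in_cell) (auto simp: defs R_def cell_def)
      moreover have "\<forall>\<^sub>F t in at_right 0. w \<bullet> x > 0 \<longrightarrow> 0 < w \<bullet> x + t * (w \<bullet> v')"
        using eventually_lex_pos[of "w \<bullet> x" "w \<bullet> v'"] by (cases "w \<bullet> x > 0") auto
      moreover have "\<forall>\<^sub>F t in at_right (0::real). 0 < t"
        by (rule eventually_at_right_less)
      ultimately have "\<forall>\<^sub>F t in at_right 0. 0 < t \<and> x + t *\<^sub>R v' \<in> R
          \<and> (w \<bullet> x > 0 \<longrightarrow> w \<bullet> (x + t *\<^sub>R v') > 0)"
        by eventually_elim (auto simp: inner_add_right)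
      then show ?thesis
        using eventually_happens trivial_limit_at_right_real by blast
    qed
    have x0: "\<eta> j \<bullet> x = 0" using x by (simp add: defs)
    show "\<exists>y\<in>Rneg. w \<bullet> x > 0 \<longrightarrow> w \<bullet> y > 0"
      using *[of "- v"] v U(1) x0 unfolding defs
      by (force simp: subspace_neg inner_add_right inner_diff_right)
    show "\<exists>y\<in>Rpos. w \<bullet> x > 0 \<longrightarrow> w \<bullet> y > 0"
      using *[of v] v U(1) x0 unfolding defs
      by (force simp: inner_add_right)
  qed
  have cross: "\<exists>z\<in>Rzero. (w \<bullet> x > 0 \<and> w \<bullet> y > 0 \<longrightarrow> w \<bullet> z > 0)" if "x \<in> Rneg" "y \<in> Rpos" for x y
  proof -
    have xy: "x \<in> R" "y \<in> R" "\<eta> j \<bullet> x < 0" "0 < \<eta> j \<bullet> y" using that by (auto simp: defs)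
    obtain s where s: "0 < s" "s < 1" "(1 - s) *\<^sub>R x + s *\<^sub>R y \<in> R"
      "\<eta> j \<bullet> ((1 - s) *\<^sub>R x + s *\<^sub>R y) = 0"
      using convex_crosses_hyperplane[OF R xy] by blast
    have "w \<bullet> ((1 - s) *\<^sub>R x + s *\<^sub>R y) > 0" if "w \<bullet> x > 0" "w \<bullet> y > 0"
      using that s by (simp add: inner_add_right add_pos_pos)
    with s show ?thesis unfolding defs by blast
  qed
  have "(of_bool (in_polar w Rneg) :: int) + of_bool (in_polar w Rpos)
    = of_bool (in_polar w R) + of_bool (in_polar w Rzero)"
  proof (cases "Rzero = {}")
    case True
    then have "Rneg = {} \<or> Rpos = {}" using cross by blast
    with True R_Un show ?thesis by (auto simp: in_polar_def)
  next
    case False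
    then have ne: "Rneg \<noteq> {}" "Rpos \<noteq> {}" using near by blast+
    show ?thesis
    proof (cases "in_polar w Rzero")
      case True
      then have "in_polar w Rneg \<or> in_polar w Rpos"
        using cross ne by (fastforce simp: in_polar_def not_le)
      moreover have "in_polar w R \<longleftrightarrow> in_polar w Rneg \<and> in_polar w Rpos"
        using True ne unfolding R_Un in_polar_def by blast
      ultimately show ?thesis using True by auto
    next
      case False
      then obtain x where x: "x \<in> Rzero" "w \<bullet> x > 0"
        using \<open>Rzero \<noteq> {}\<close> by (auto simp: in_polar_def not_le)
      then have "\<not> in_polar w Rneg" "\<not> in_polar w Rpos"
        using near[OF x(1)] by (auto simp: in_polar_def not_le)
      moreover have "\<not> in_polar w R" using x unfolding R_Un in_polar_def by (meson UnI2 not_le)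
      ultimately show ?thesis using False by auto
    qed
  qed
  then show ?thesis
    unfolding cell_insert_neg[OF I(2,3)] cell_insert_pos[OF I(2,3)] cell_Int_hyperplane
    by (simp add: defs R_def)
qed

lemma dim_Int_hyperplane:
  fixes U :: "'a::euclidean_space set"
  assumes "subspace U" "\<not> U \<subseteq> {x. a \<bullet> x = 0}"
  shows "dim U = Suc (dim (U \<inter> {x. a \<bullet> x = 0}))"
proof -
  obtain u where u: "u \<in> U" "a \<bullet> u \<noteq> 0" using assms by blast
  let ?V = "U \<inter> {x. a \<bullet> x = 0}"
  have V: "subspace ?V" using assms by (simp add: subspace_inter subspace_hyperplane)
  have "U = span (insert u ?V)"
  proof
    show "span (insert u ?V) \<subseteq> U"
      using u assms by (intro span_minimal) auto
    show "U \<subseteq> span (insert u ?V)"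
    proof
      fix x assume x: "x \<in> U"
      define c where "c = (a \<bullet> x) / (a \<bullet> u)"
      have "x - c *\<^sub>R u \<in> ?V"
        using x u assms by (auto simp: c_def inner_diff_right subspace_diff subspace_scale)
      then show "x \<in> span (insert u ?V)"
        by (meson insertI1 span_base span_breakdown_eq)
    qed
  qed
  then have "dim U = dim (insert u ?V)" by (metis dim_span)
  moreover have "u \<notin> span ?V"
    using u V by (simp add: span_eq_iff[THEN iffD2])
  ultimately show ?thesis by (simp add: dim_insert)
qed

text \<open>Both sides satisfy the same deletion-restriction recurrence, and both vanish when the
  added hyperplane contains \<open>U\<close>.\<close>

lemma card_cells_in_polar:
  assumes "finite I" "subspace U"
  shows "(\<Sum>P\<in>Pow I. of_bool (in_polar w (cell \<eta> U I P)) :: int)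
    = (\<Sum>J\<in>Pow I. (-1) ^ card J * (-1) ^ (dim U + dim (U \<inter> flat \<eta> J))
         * of_bool (\<forall>x\<in>U \<inter> flat \<eta> J. w \<bullet> x = 0))"
  using assms
proof (induction I arbitrary: U rule: finite_induct)
  case empty
  \<comment> \<open>A subspace contained in a halfspace through the origin lies in its
    boundary.\<close>
  have "(\<forall>x\<in>U. w \<bullet> x \<le> 0) \<longleftrightarrow> (\<forall>x\<in>U. w \<bullet> x = 0)"
  proof safe
    fix x assume *: "\<forall>x\<in>U. w \<bullet> x \<le> 0" "x \<in> U"
    then have "- x \<in> U" using empty by (simp add: subspace_neg)
    then have "w \<bullet> (- x) \<le> 0" using * by blast
    with * show "w \<bullet> x = 0" by (simp add: order_antisym)
  qed simp
  moreover have "U \<noteq> {}" using empty subspace_0 by blast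
  ultimately show ?case by (simp add: in_polar_def cell_def)
next
  case (insert j I)
  let ?H = "{x. \<eta> j \<bullet> x = 0}"
  \<comment> \<open>The sign keeps \<open>dim U\<close> even when \<open>V\<close> is the restricted
    space. Adding \<open>j\<close> to \<open>J\<close> then amounts to intersecting with the
    hyperplane and flipping the sign through \<open>card J\<close>.\<close>
  let ?f = "\<lambda>V J. (-1::int) ^ card J * (-1) ^ (dim U + dim (V \<inter> flat \<eta> J))
      * of_bool (\<forall>x\<in>V \<inter> flat \<eta> J. w \<bullet> x = 0)"
  have R: "(\<Sum>J\<in>Pow (insert j I). ?f U J) = (\<Sum>J\<in>Pow I. ?f U J - ?f (U \<inter> ?H) J)"
    unfolding sum_Pow_insert[OF insert.hyps]
  proof (rule sum.cong)
    fix J assume "J \<in> Pow I"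
    then have "j \<notin> J" "finite J" using insert.hyps finite_subset by auto
    then have "card (insert j J) = Suc (card J)" by simp
    then show "?f U J + ?f U (insert j J) = ?f U J - ?f (U \<inter> ?H) J"
      by (simp add: flat_insert Int_assoc)
  qed simp
  show ?case
  proof (cases "U \<subseteq> ?H")
    \<comment> \<open>No point of \<open>U\<close> has a nonzero sign at \<open>j\<close>, so there
      are no cells, and on the right the terms cancel in pairs.\<close>
    case True
    then have UH: "U \<inter> ?H = U" by blast
    have L: "cell \<eta> U (insert j I) P = {}" if "P \<subseteq> insert j I" for P
      using True by (cases "j \<in> P") (force simp: cell_def)+
    have "(\<Sum>P\<in>Pow (insert j I). of_bool (in_polar w (cell \<eta> U (insert j I) P)) :: int) = 0"
      by (rule sum.neutral) (auto simp: L in_polar_def)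
    then show ?thesis unfolding R UH by simp
  next
    case False
    have sub: "subspace (U \<inter> ?H)"
      using insert.prems by (simp add: subspace_inter subspace_hyperplane)
    have "(\<Sum>P\<in>Pow (insert j I). of_bool (in_polar w (cell \<eta> U (insert j I) P)) :: int)
      = (\<Sum>P\<in>Pow I. of_bool (in_polar w (cell \<eta> U I P)) + of_bool (in_polar w (cell \<eta> (U \<inter> ?H) I P)))"
      unfolding sum_Pow_insert[OF insert.hyps]
      using insert.hyps insert.prems False
      by (intro sum.cong in_polar_deletion_restriction) auto
    \<comment> \<open>Restriction lowers the ambient dimension by one, which supplies the minus
      sign.\<close>
    also have "\<dots> = (\<Sum>J\<in>Pow I. ?f U J - ?f (U \<inter> ?H) J)"
      unfolding sum.distrib insert.IH[OF insert.prems] insert.IH[OF sub] sum_subtractf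
      by (simp add: dim_Int_hyperplane[OF insert.prems False] sum_negf)
    finally show ?thesis unfolding R .
  qed
qed

section \<open>Whitney's formula for the Moebius function\<close>

lemma sum_Pow_minus_one_power_card:
  assumes "finite I" "I \<noteq> {}"
  shows "(\<Sum>J\<in>Pow I. (-1::int) ^ card J) = 0"
proof -
  obtain j where j: "j \<in> I" using assms by blast
  have "(\<Sum>J\<in>Pow (insert j (I - {j})). (-1::int) ^ card J) = 0"
  proof (subst sum_Pow_insert)
    have "card (insert j J) = Suc (card J)" if "J \<subseteq> I - {j}" for J
      using that assms finite_subset[of J I] by (subst card_insert_disjoint) auto
    then show "(\<Sum>J\<in>Pow (I - {j}). (-1::int) ^ card J + (-1) ^ card (insert j J)) = 0"
      by (intro sum.neutral) auto
  qed (use assms in auto)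
  then show ?thesis using j by (simp add: insert_absorb)
qed

lemma intersection_lattice_eq:
  "intersection_lattice ((\<lambda>i. central_hyperplane (\<eta> i)) ` I) = flat \<eta> ` Pow I"
proof -
  have "flat \<eta> J = \<Inter>((\<lambda>i. central_hyperplane (\<eta> i)) ` J)" for J
    by (auto simp: flat_def central_hyperplane_def)
  then show ?thesis
    unfolding intersection_lattice_def by (auto simp: subset_image_iff)
qed

text \<open>The right-hand side satisfies the recursion of the Moebius function. Summed over all
  flats containing \<open>X\<close>, it becomes the alternating sum over all sets of hyperplanes
  through \<open>X\<close>, which vanishes if there is such a hyperplane. The induction is on the
  number of strictly larger flats.\<close>

lemma moebius_flat:
  assumes I: "finite I" "\<And>i. i \<in> I \<Longrightarrow> \<eta> i \<noteq> 0" and "X \<in> flat \<eta> ` Pow I"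
  shows "moebius (flat \<eta> ` Pow I) UNIV X = (\<Sum>J\<in>{J\<in>Pow I. flat \<eta> J = X}. (-1) ^ card J)"
  using assms(3)
proof (induction "card {Y\<in>flat \<eta> ` Pow I. X \<subset> Y}" arbitrary: X rule: less_induct)
  case less
  let ?L = "flat \<eta> ` Pow I"
  let ?f = "\<lambda>X. \<Sum>J\<in>{J\<in>Pow I. flat \<eta> J = X}. (-1::int) ^ card J"
  have fin: "finite ?L" using I by simp
  have UNIV: "UNIV \<in> ?L" by (rule image_eqI[of _ _ "{}"]) auto
  show ?case
  proof (cases "X = UNIV")
    case True
    \<comment> \<open>A nonzero normal is not orthogonal to itself, so a nonempty \<open>J\<close>
      cannot have the whole space as its flat.\<close>
    have "J = {}" if J: "J \<subseteq> I" "flat \<eta> J = UNIV" for J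
    proof (rule ccontr)
      assume "J \<noteq> {}"
      then obtain i where i: "i \<in> J" by blast
      have "\<eta> i \<in> flat \<eta> J" using J by simp
      then have "\<eta> i \<bullet> \<eta> i = 0" using i by (auto simp: flat_def)
      then show False using i J I by auto
    qed
    then have "{J\<in>Pow I. flat \<eta> J = UNIV} = {{}}" by auto
    then show ?thesis using True fin UNIV by (simp add: moebius.simps)
  next
    case False
    \<comment> \<open>For \<open>J \<subseteq> I\<close>, the flat of \<open>J\<close> contains
      \<open>X\<close> exactly if \<open>J \<subseteq> K\<close>.\<close>
    define K where "K = {i\<in>I. \<forall>x\<in>X. \<eta> i \<bullet> x = 0}"
    have "K \<noteq> {}"
      using less.prems False by (auto simp: K_def flat_def)
    have "(\<Sum>Y\<in>{Y\<in>?L. X \<subseteq> Y}. ?f Y) = (\<Sum>J\<in>Pow K. (-1::int) ^ card J)"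
    proof -
      have "(\<Sum>J\<in>Pow K. (-1::int) ^ card J)
        = (\<Sum>Y\<in>{Y\<in>?L. X \<subseteq> Y}. \<Sum>J\<in>{J\<in>Pow K. flat \<eta> J = Y}. (-1::int) ^ card J)"
      proof (rule sum.group[symmetric])
        show "flat \<eta> ` Pow K \<subseteq> {Y\<in>?L. X \<subseteq> Y}"
          unfolding K_def by (auto simp: flat_def)
      qed (use I in \<open>auto simp: K_def\<close>)
      also have "\<dots> = (\<Sum>Y\<in>{Y\<in>?L. X \<subseteq> Y}. ?f Y)"
      proof (intro sum.cong refl)
        fix Y assume "Y \<in> {Y\<in>?L. X \<subseteq> Y}"
        then have "J \<subseteq> K" if "J \<subseteq> I" "flat \<eta> J = Y" for J
          using that by (auto simp: K_def flat_def)
        then show "{J\<in>Pow K. flat \<eta> J = Y} = {J\<in>Pow I. flat \<eta> J = Y}"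
          by (auto simp: K_def)
      qed
      finally show ?thesis by simp
    qed
    also have "\<dots> = 0"
      using I \<open>K \<noteq> {}\<close> by (intro sum_Pow_minus_one_power_card) (auto simp: K_def)
    finally have "(\<Sum>Y\<in>{Y\<in>?L. X \<subseteq> Y}. ?f Y) = 0" .
    moreover have "{Y\<in>?L. X \<subseteq> Y} = insert X {Y\<in>?L. X \<subset> Y}" using less.prems by auto
    ultimately have f: "?f X = - (\<Sum>Y\<in>{Y\<in>?L. X \<subset> Y}. ?f Y)"
      using fin by simp
    have "moebius ?L UNIV X = - (\<Sum>Y\<in>{Y\<in>?L. X \<subset> Y}. moebius ?L UNIV Y)"
      using False fin UNIV less.prems by (subst moebius.simps) auto
    also have "(\<Sum>Y\<in>{Y\<in>?L. X \<subset> Y}. moebius ?L UNIV Y) = (\<Sum>Y\<in>{Y\<in>?L. X \<subset> Y}. ?f Y)"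
    proof (rule sum.cong)
      fix Y assume Y: "Y \<in> {Y\<in>?L. X \<subset> Y}"
      then have "{Z\<in>?L. Y \<subset> Z} \<subset> {Z\<in>?L. X \<subset> Z}" by blast
      then have "card {Z\<in>?L. Y \<subset> Z} < card {Z\<in>?L. X \<subset> Z}"
        using fin by (intro psubset_card_mono) auto
      then show "moebius ?L UNIV Y = ?f Y" using Y by (intro less.hyps) auto
    qed simp
    finally show ?thesis using f by simp
  qed
qed

section \<open>Regions as nonempty cells\<close>

lemma cell_disjoint:
  assumes "P \<subseteq> I" "Q \<subseteq> I" "x \<in> cell \<eta> U I P" "x \<in> cell \<eta> U I Q"
  shows "P = Q"
  using assms by (auto simp: cell_def) (meson DiffI less_asym subsetD)+

text \<open>The cells are open, convex and pairwise disjoint, and they cover the complement of the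
  hyperplanes. A connected set containing one nonempty cell cannot also meet the open union of the
  others, so such a cell is a maximal connected subset.\<close>

lemma regions_eq_cells:
  assumes "finite I"
  shows "regions ((\<lambda>i. central_hyperplane (\<eta> i)) ` I)
    = cell \<eta> UNIV I ` {P\<in>Pow I. cell \<eta> UNIV I P \<noteq> {}}"
proof -
  let ?S = "UNIV - \<Union>((\<lambda>i. central_hyperplane (\<eta> i)) ` I)"
  have S: "?S = (\<Union>P\<in>Pow I. cell \<eta> UNIV I P)"
  proof (intro set_eqI iffI)
    fix x assume "x \<in> ?S"
    then have "\<eta> i \<bullet> x \<noteq> 0" if "i \<in> I" for i
      using that by (auto simp: central_hyperplane_def)
    then have "\<eta> i \<bullet> x < 0" if "i \<in> I - {i\<in>I. 0 < \<eta> i \<bullet> x}" for i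
      using that by (metis (mono_tags, lifting) DiffE linorder_cases mem_Collect_eq)
    then have "x \<in> cell \<eta> UNIV I {i\<in>I. 0 < \<eta> i \<bullet> x}"
      by (simp add: cell_def)
    then show "x \<in> (\<Union>P\<in>Pow I. cell \<eta> UNIV I P)" by (intro UN_I) auto
  next
    fix x assume "x \<in> (\<Union>P\<in>Pow I. cell \<eta> UNIV I P)"
    then obtain P where "x \<in> cell \<eta> UNIV I P" by blast
    then have "\<eta> i \<bullet> x \<noteq> 0" if "i \<in> I" for i
      using that by (cases "i \<in> P") (force simp: cell_def)+
    then show "x \<in> ?S" by (auto simp: central_hyperplane_def)
  qed
  have comp: "cell \<eta> UNIV I P \<in> components ?S" if P: "P \<subseteq> I" "cell \<eta> UNIV I P \<noteq> {}" for P
    unfolding in_components_maximal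
  proof (intro conjI allI impI)
    show "cell \<eta> UNIV I P \<subseteq> ?S" using P unfolding S by blast
    show "connected (cell \<eta> UNIV I P)"
      by (intro convex_connected convex_cell) simp
    fix D assume D: "D \<noteq> {} \<and> cell \<eta> UNIV I P \<subseteq> D \<and> D \<subseteq> ?S \<and> connected D"
    let ?T = "\<Union>Q\<in>Pow I - {P}. cell \<eta> UNIV I Q"
    have "open (cell \<eta> UNIV I P)" "open ?T"
      using assms P by (auto intro!: open_cell)
    moreover have cover: "D \<subseteq> cell \<eta> UNIV I P \<union> ?T" using D unfolding S by blast
    moreover have "cell \<eta> UNIV I P \<inter> ?T \<inter> D = {}" using cell_disjoint P by blast
    ultimately have "cell \<eta> UNIV I P \<inter> D = {} \<or> ?T \<inter> D = {}"
      using D by (intro connectedD) auto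
    moreover have "cell \<eta> UNIV I P \<inter> D = cell \<eta> UNIV I P" using D by blast
    ultimately have "?T \<inter> D = {}" using P(2) by simp
    with cover have "D \<subseteq> cell \<eta> UNIV I P" by auto
    with D show "D = cell \<eta> UNIV I P" by simp
  qed (use P in auto)
  show ?thesis
    unfolding regions_def
  proof
    show "cell \<eta> UNIV I ` {P \<in> Pow I. cell \<eta> UNIV I P \<noteq> {}} \<subseteq> components ?S"
      using comp by blast
    show "components ?S \<subseteq> cell \<eta> UNIV I ` {P \<in> Pow I. cell \<eta> UNIV I P \<noteq> {}}"
    proof
      fix C assume C: "C \<in> components ?S"
      then obtain x where "x \<in> C"
        using in_components_nonempty[OF C] by auto
      then have "x \<in> ?S" using in_components_subset[OF C] by (rule rev_subsetD)
      then obtain P where P: "P \<in> Pow I" "x \<in> cell \<eta> UNIV I P" unfolding S by (rule UN_E)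
      then have "C = cell \<eta> UNIV I P"
        using components_eq[OF C comp[of P]] \<open>x \<in> C\<close> by auto
      with P show "C \<in> cell \<eta> UNIV I ` {P \<in> Pow I. cell \<eta> UNIV I P \<noteq> {}}" by auto
    qed
  qed
qed

text \<open>Lets sums over regions run over sign sets. Repeated hyperplanes do no harm, because
  inconsistent sign sets have empty cells.\<close>

lemma inj_on_cell: "inj_on (cell \<eta> UNIV I) {P\<in>Pow I. cell \<eta> UNIV I P \<noteq> {}}"
proof (rule inj_onI)
  fix P Q assume *: "P \<in> {P\<in>Pow I. cell \<eta> UNIV I P \<noteq> {}}" "Q \<in> {P\<in>Pow I. cell \<eta> UNIV I P \<noteq> {}}"
    "cell \<eta> UNIV I P = cell \<eta> UNIV I Q"
  then obtain x where "x \<in> cell \<eta> UNIV I P" "x \<in> cell \<eta> UNIV I Q" "P \<subseteq> I" "Q \<subseteq> I" by auto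
  then show "P = Q" by (intro cell_disjoint)
qed

section \<open>Nearest points and generic points\<close>

text \<open>Converse of the obtuse angle criterion: writing \<open>z - c\<close> as
  \<open>(z - p) - (c - p)\<close> and expanding the square, the mixed term only increases the
  distance.\<close>

lemma closest_point_eqI:
  fixes C :: "'a::euclidean_space set"
  assumes "convex C" "closed C" "p \<in> C" "\<And>c. c \<in> C \<Longrightarrow> (z - p) \<bullet> (c - p) \<le> 0"
  shows "closest_point C z = p"
proof -
  have "dist z p \<le> dist z c" if "c \<in> C" for c
  proof -
    have "norm (z - p) ^ 2 \<le> norm (z - p) ^ 2 + norm (c - p) ^ 2 - 2 * ((z - p) \<bullet> (c - p))"
      using assms(4)[OF that] zero_le_power2[of "norm (c - p)"] by linarith
    also have "\<dots> = norm ((z - p) - (c - p)) ^ 2"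
      by (simp only: power2_norm_eq_inner inner_diff_left inner_diff_right inner_commute)
        (simp add: algebra_simps)
    finally have "norm (z - p) ^ 2 \<le> norm (z - c) ^ 2" by simp
    then show ?thesis unfolding dist_norm by (rule power2_le_imp_le) simp
  qed
  then show ?thesis using closest_point_unique[OF assms(1-3)] by auto
qed

lemma closest_point_subspace:
  fixes X :: "'a::euclidean_space set"
  assumes X: "subspace X"
  shows "closest_point X z \<in> X" "x \<in> X \<Longrightarrow> (z - closest_point X z) \<bullet> x = 0"
proof -
  let ?p = "closest_point X z"
  have ne: "X \<noteq> {}" using X subspace_0 by blast
  show p: "?p \<in> X"
    using closest_point_in_set[OF closed_subspace[OF X] ne] .
  \<comment> \<open>The obtuse angle criterion at the point \<open>?p + y\<close>; applying it to
    \<open>- y\<close> as well gives orthogonality.\<close>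
  have le: "(z - ?p) \<bullet> y \<le> 0" if "y \<in> X" for y
    using closest_point_dot[OF subspace_imp_convex[OF X] closed_subspace[OF X], of "?p + y" z]
      subspace_add[OF X p that] by simp
  show "(z - ?p) \<bullet> x = 0" if "x \<in> X"
    using le[OF that] le[OF subspace_neg[OF X that]] by simp
qed

lemma closest_point_subspace_eqI:
  fixes X :: "'a::euclidean_space set"
  assumes X: "subspace X" "p \<in> X" "\<And>x. x \<in> X \<Longrightarrow> (z - p) \<bullet> x = 0"
  shows "closest_point X z = p"
  using assms by (intro closest_point_eqI) (auto simp: subspace_imp_convex closed_subspace subspace_diff)

text \<open>Excludes coincidences between nested flats only. This suffices to keep the projection to
  a flat off all hyperplanes that do not contain the flat, and to make \<open>X\<close> the only
  flat containing \<open>X\<close> that is orthogonal to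
  \<open>z - closest_point X z\<close>.\<close>

definition generic :: "'a::euclidean_space set set \<Rightarrow> 'a \<Rightarrow> bool" where
  "generic L z \<longleftrightarrow> (\<forall>X\<in>L. \<forall>Y\<in>L. X \<subseteq> Y \<and> closest_point X z = closest_point Y z \<longrightarrow> X = Y)"

lemma genericD:
  "generic L z \<Longrightarrow> X \<in> L \<Longrightarrow> Y \<in> L \<Longrightarrow> X \<subseteq> Y \<Longrightarrow> closest_point X z = closest_point Y z \<Longrightarrow> X = Y"
  by (simp add: generic_def)

text \<open>For \<open>X\<close> strictly inside \<open>Y\<close> there is a nonzero
  \<open>v\<close> in \<open>Y\<close> orthogonal to \<open>X\<close>. Equal projections of
  \<open>z\<close> force \<open>v \<bullet> z = 0\<close>, so the exceptional points lie in finitely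
  many hyperplanes.\<close>

lemma negligible_not_generic:
  assumes "finite L" "\<And>X. X \<in> L \<Longrightarrow> subspace X"
  shows "negligible {z. \<not> generic L z}"
proof -
  have neg: "negligible {z. closest_point X z = closest_point Y z}"
    if "X \<in> L" "Y \<in> L" "X \<subset> Y" for X Y
  proof -
    have sub: "subspace X" "subspace Y" using assms that by auto
    then have "span X \<subset> span Y" using that by (simp add: span_eq_iff[THEN iffD2])
    then obtain v where v: "v \<noteq> 0" "v \<in> Y" "\<And>x. x \<in> X \<Longrightarrow> v \<bullet> x = 0"
      using orthogonal_to_subspace_exists_gen[of X Y] sub
      by (auto simp: span_eq_iff[THEN iffD2] orthogonal_def)
    have "v \<bullet> z = 0" if "closest_point X z = closest_point Y z" for z
    proof -
      have "(z - closest_point X z) \<bullet> v = 0"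
        using closest_point_subspace(2)[OF sub(2) v(2), of z] that by simp
      moreover have "v \<bullet> closest_point X z = 0"
        using closest_point_subspace(1)[OF sub(1)] v(3) by blast
      ultimately show ?thesis by (simp add: inner_diff_left inner_commute[of v])
    qed
    then have "{z. closest_point X z = closest_point Y z} \<subseteq> {z. v \<bullet> z = 0}" by blast
    then show ?thesis
      using negligible_hyperplane[of v 0] v negligible_subset by blast
  qed
  have "{z. \<not> generic L z} = (\<Union>X\<in>L. \<Union>Y\<in>{Y\<in>L. X \<subset> Y}. {z. closest_point X z = closest_point Y z})"
    by (auto simp: generic_def psubset_eq)
  also have "negligible \<dots>"
    using assms(1) neg by (intro negligible_Union) (auto intro!: negligible_Union)
  finally show ?thesis .
qed

section \<open>Pointwise count of the pairs of a region and a face\<close>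

text \<open>The set \<open>F\<close> is the face of the closed cell cut out by the hyperplanes
  through \<open>p\<close>. The other inequalities are strict at \<open>p\<close> and remain so
  nearby, hence around \<open>p\<close> the face coincides with the flat.\<close>

lemma closed_cell_face:
  assumes I: "finite I" "P \<subseteq> I" and p: "p \<in> closed_cell \<eta> I P"
  defines "K \<equiv> {i\<in>I. \<eta> i \<bullet> p = 0}"
  defines "F \<equiv> closed_cell \<eta> I P \<inter> flat \<eta> K"
  shows "F face_of closed_cell \<eta> I P" "p \<in> rel_interior F" "aff_dim F = int (dim (flat \<eta> K))"
    "\<And>x. x \<in> flat \<eta> K \<Longrightarrow> \<exists>t>0. p + t *\<^sub>R x \<in> closed_cell \<eta> I P"
proof -
  let ?C = "closed_cell \<eta> I P" and ?X = "flat \<eta> K"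
  \<comment> \<open>The open neighbourhood of \<open>p\<close> where the inequalities that are
    strict at \<open>p\<close> stay strict; it witnesses the relative interior and determines the
    affine hull.\<close>
  let ?T = "cell \<eta> UNIV (I - K) (P - K)"
  have conv: "convex ?C" using polyhedron_closed_cell[OF I] polyhedron_imp_convex by blast
  show "F face_of ?C"
  proof (cases "K = {}")
    case True
    then show ?thesis using conv by (simp add: F_def face_of_refl)
  next
    case False
    have "F = \<Inter>((\<lambda>i. ?C \<inter> {x. \<eta> i \<bullet> x = 0}) ` K)"
      using False by (auto simp: F_def flat_def)
    moreover have "?C \<inter> {x. \<eta> i \<bullet> x = 0} face_of ?C" if "i \<in> K" for i
    proof (cases "i \<in> P")
      case True
      then show ?thesis
        using conv by (intro face_of_Int_supporting_hyperplane_ge) (auto simp: closed_cell_def)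
    next
      case False
      then show ?thesis
        using conv that by (intro face_of_Int_supporting_hyperplane_le) (auto simp: closed_cell_def K_def)
    qed
    ultimately show ?thesis
      using False by (metis (no_types, lifting) face_of_Inter imageE image_is_empty)
  qed
  have pX: "p \<in> ?X" by (auto simp: flat_def K_def)
  have pF: "p \<in> F" using p pX by (simp add: F_def)
  have pT: "p \<in> ?T"
    using p I by (auto simp: cell_def closed_cell_def K_def order_less_le)
  have TX: "?X \<inter> ?T \<subseteq> F"
  proof
    fix x assume x: "x \<in> ?X \<inter> ?T"
    have "0 \<le> \<eta> i \<bullet> x" if "i \<in> P" for i
      using x that by (cases "i \<in> K") (auto simp: cell_def flat_def intro: less_imp_le)
    moreover have "\<eta> i \<bullet> x \<le> 0" if "i \<in> I - P" for i
      using x that by (cases "i \<in> K") (auto simp: cell_def flat_def intro: less_imp_le)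
    ultimately show "x \<in> F" using x by (simp add: F_def closed_cell_def)
  qed
  have T: "open ?T" using I by (intro open_cell) auto
  have aff: "affine ?X" by (intro subspace_imp_affine subspace_flat)
  have hull: "affine hull F = ?X"
  proof
    show "affine hull F \<subseteq> ?X" using aff by (intro hull_minimal) (auto simp: F_def)
    have "?X \<inter> ?T \<noteq> {}" using pX pT by (metis IntI empty_iff)
    then have "?X = affine hull (?X \<inter> ?T)"
      using affine_hull_affine_Int_open[OF aff T] hull_same[of affine, OF aff] by simp
    also have "\<dots> \<subseteq> affine hull F" using TX by (rule hull_mono)
    finally show "?X \<subseteq> affine hull F" .
  qed
  show "p \<in> rel_interior F"
    unfolding mem_rel_interior hull
    using T pT pF TX by (intro exI[of _ ?T]) (simp add: Int_commute)
  show "aff_dim F = int (dim ?X)"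
    by (metis hull aff_dim_affine_hull aff_dim_subspace subspace_flat)
  show "\<exists>t>0. p + t *\<^sub>R x \<in> ?C" if x: "x \<in> ?X" for x
  proof -
    have "\<forall>\<^sub>F t in at_right 0. p + t *\<^sub>R x \<in> cell \<eta> ?X (I - K) (P - K)"
      using I pX x pT by (intro eventually_in_cell subspace_flat) (auto simp: cell_def)
    moreover have "cell \<eta> ?X (I - K) (P - K) \<subseteq> ?C"
      using TX by (auto simp: F_def cell_def)
    moreover have "\<forall>\<^sub>F t in at_right (0::real). 0 < t"
      by (rule eventually_at_right_less)
    ultimately have "\<forall>\<^sub>F t in at_right 0. 0 < t \<and> p + t *\<^sub>R x \<in> ?C"
      by (auto elim: eventually_elim2)
    then show ?thesis
      using eventually_happens trivial_limit_at_right_real by blast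
  qed
qed

lemma sum_of_bool_eq: "finite A \<Longrightarrow> (\<Sum>y\<in>A. of_bool (x = y)) = (of_bool (x \<in> A) :: real)"
  by (simp add: of_bool_def sum.delta')

text \<open>Replaces faces, which depend on the cell, by flats, which do not. Relative interiors of
  distinct faces are disjoint, so on the left only the face around the projection of
  \<open>z\<close> counts. Genericity leaves only the flat spanned by that face on the
  right.\<close>

lemma sum_faces_projection_cone:
  assumes I: "finite I" "P \<subseteq> I" and z: "generic (flat \<eta> ` Pow I) z"
  defines "C \<equiv> closed_cell \<eta> I P"
  shows "(\<Sum>F\<in>{F. F face_of C \<and> aff_dim F = int k}. indicator (projection_cone C F) z :: real)
    = (\<Sum>X\<in>{X\<in>flat \<eta> ` Pow I. dim X = k}. of_bool (closest_point C z = closest_point X z))"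
proof -
  have poly: "polyhedron C" unfolding C_def by (rule polyhedron_closed_cell[OF I])
  have C: "convex C" "closed C" using poly polyhedron_imp_convex polyhedron_imp_closed by auto
  have "0 \<in> C" by (simp add: C_def closed_cell_def)
  then have "closest_point C z \<in> C" using C closest_point_in_set by blast
  define p where "p = closest_point C z"
  have p: "p \<in> closed_cell \<eta> I P" using \<open>closest_point C z \<in> C\<close> by (simp add: p_def C_def)
  define K where "K = {i\<in>I. \<eta> i \<bullet> p = 0}"
  define X where "X = flat \<eta> K"
  define F where "F = C \<inter> X"
  note face = closed_cell_face[OF I p, folded K_def, folded X_def C_def, folded F_def]
  have X: "X \<in> flat \<eta> ` Pow I" by (auto simp: X_def K_def)
  \<comment> \<open>From \<open>p\<close> one can move inside \<open>C\<close> a little in any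
    direction of \<open>X\<close>. Doing so along \<open>x\<close> and \<open>- x\<close> shows
    \<open>z - p\<close> orthogonal to \<open>X\<close>, so \<open>p\<close> is also the projection
    to \<open>X\<close>.\<close>
  have le: "(z - p) \<bullet> x \<le> 0" if x: "x \<in> X" for x
  proof -
    obtain t where "t > 0" "p + t *\<^sub>R x \<in> C" using face(4)[OF x] by blast
    then show ?thesis
      using closest_point_dot[OF C, of "p + t *\<^sub>R x" z] by (simp add: p_def mult_le_0_iff)
  qed
  have "(z - p) \<bullet> x = 0" if "x \<in> X" for x
    using le[OF that] le[of "- x"] that subspace_neg[OF subspace_flat] by (force simp: X_def)
  then have pX: "closest_point X z = p"
    unfolding X_def
    by (intro closest_point_subspace_eqI subspace_flat) (auto simp: flat_def K_def)
  have "(\<Sum>F'\<in>{F. F face_of C \<and> aff_dim F = int k}. indicator (projection_cone C F') z :: real)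
    = (\<Sum>F'\<in>{F. F face_of C \<and> aff_dim F = int k}. of_bool (F = F'))"
  proof (rule sum.cong)
    fix F' assume "F' \<in> {F. F face_of C \<and> aff_dim F = int k}"
    then have "p \<in> rel_interior F' \<longleftrightarrow> F = F'"
      using face_of_eq[OF face(1), of F'] face(2) by blast
    then show "(indicator (projection_cone C F') z :: real) = of_bool (F = F')"
      by (simp add: projection_cone_def p_def indicator_def)
  qed simp
  also have "\<dots> = of_bool (dim X = k)"
    using finite_subset[OF _ finite_polyhedron_faces[OF poly], of "{F. F face_of C \<and> aff_dim F = int k}"]
      face(1,3) by (subst sum_of_bool_eq) auto
  also have "\<dots> = (\<Sum>Y\<in>{X\<in>flat \<eta> ` Pow I. dim X = k}. of_bool (X = Y))"
    using I X by (subst sum_of_bool_eq) auto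
  also have "\<dots> = (\<Sum>Y\<in>{X\<in>flat \<eta> ` Pow I. dim X = k}. of_bool (closest_point C z = closest_point Y z))"
  proof (rule sum.cong)
    fix Y assume Y: "Y \<in> {X\<in>flat \<eta> ` Pow I. dim X = k}"
    \<comment> \<open>The hyperplanes defining \<open>Y\<close> pass through \<open>p\<close>, so
      they are among those indexed by \<open>K\<close> and \<open>X\<close> is contained in
      \<open>Y\<close>.\<close>
    have "X = Y" if eq: "p = closest_point Y z"
    proof (rule genericD[OF z X])
      obtain J where J: "J \<subseteq> I" "Y = flat \<eta> J" using Y by auto
      have "p \<in> Y" unfolding eq J by (intro closest_point_subspace subspace_flat)
      then have "J \<subseteq> K" using J by (auto simp: flat_def K_def)
      then show "X \<subseteq> Y" by (auto simp: X_def J flat_def)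
    qed (use Y pX eq in auto)
    then show "(of_bool (X = Y) :: real) = of_bool (closest_point C z = closest_point Y z)"
      using pX by (auto simp: p_def)
  qed simp
  finally show ?thesis .
qed

text \<open>Localization at \<open>X\<close>. Outside \<open>K\<close> the signs of a cell with
  \<open>p\<close> in its closure are those of \<open>p\<close>, so the cell is determined by its
  signs on \<open>K\<close>. Near \<open>p\<close> it looks like the localized cell translated by
  \<open>p\<close>, and the obtuse angle criterion becomes \<open>in_polar\<close>.\<close>

lemma card_cells_projecting_to_flat:
  assumes I: "finite I" and z: "generic (flat \<eta> ` Pow I) z" and X: "X \<in> flat \<eta> ` Pow I"
  defines "p \<equiv> closest_point X z" and "K \<equiv> {i\<in>I. \<forall>x\<in>X. \<eta> i \<bullet> x = 0}"
  shows "card {P\<in>Pow I. cell \<eta> UNIV I P \<noteq> {} \<and> closest_point (closed_cell \<eta> I P) z = p}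
    = card {Q\<in>Pow K. in_polar (z - p) (cell \<eta> UNIV K Q)}"
proof -
  define S where "S = {i\<in>I - K. 0 < \<eta> i \<bullet> p}"
  obtain J where J: "J \<subseteq> I" "X = flat \<eta> J" using X by auto
  have subX: "subspace X" using J subspace_flat by auto
  have pX: "p \<in> X" unfolding p_def by (rule closest_point_subspace(1)[OF subX])
  have pK: "\<eta> i \<bullet> p = 0" if "i \<in> K" for i using that pX by (simp add: K_def)
  \<comment> \<open>Otherwise intersecting \<open>X\<close> with this hyperplane would give a
    strictly smaller flat with the same projection of \<open>z\<close>.\<close>
  have pnK: "\<eta> i \<bullet> p \<noteq> 0" if i: "i \<in> I - K" for i
  proof
    assume 0: "\<eta> i \<bullet> p = 0"
    define Y where "Y = flat \<eta> (insert i J)"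
    have YX: "Y = {x. \<eta> i \<bullet> x = 0} \<inter> X" by (simp add: Y_def J flat_insert)
    have "closest_point Y z = p"
      using 0 pX closest_point_subspace(2)[OF subX, of _ z]
      by (intro closest_point_subspace_eqI) (auto simp: YX p_def Y_def[symmetric] subspace_inter subX subspace_hyperplane)
    moreover have "Y \<in> flat \<eta> ` Pow I" using i J by (auto simp: Y_def)
    ultimately have "Y = X"
      using genericD[OF z _ X, of Y] YX by (simp add: p_def)
    then show False using i YX by (auto simp: K_def)
  qed
  have K: "finite K" "K \<subseteq> I" using I by (auto simp: K_def)
  have S: "S \<subseteq> I" "S \<inter> K = {}" by (auto simp: S_def)
  \<comment> \<open>A small step from \<open>p\<close> into a localized cell lands in the cell of
    the whole arrangement whose remaining signs are those of \<open>p\<close>.\<close>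
  have move: "\<exists>t>0. p + t *\<^sub>R x \<in> cell \<eta> UNIV I (Q \<union> S)"
    if Q: "Q \<subseteq> K" "x \<in> cell \<eta> UNIV K Q" for Q x
  proof -
    have "\<forall>\<^sub>F t in at_right 0. p + t *\<^sub>R x \<in> cell \<eta> UNIV I (Q \<union> S)"
    proof (rule eventually_in_cell)
      fix i assume "i \<in> Q \<union> S"
      then show "0 < \<eta> i \<bullet> p \<or> 0 \<le> \<eta> i \<bullet> p \<and> 0 < \<eta> i \<bullet> x"
        using Q pK by (auto simp: S_def cell_def)
    next
      fix i assume i: "i \<in> I - (Q \<union> S)"
      show "\<eta> i \<bullet> p < 0 \<or> \<eta> i \<bullet> p \<le> 0 \<and> \<eta> i \<bullet> x < 0"
      proof (cases "i \<in> K")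
        case True
        then show ?thesis using i Q pK by (auto simp: cell_def)
      next
        case False
        then show ?thesis using i pnK[of i] by (auto simp: S_def)
      qed
    qed (use I K S Q in auto)
    moreover have "\<forall>\<^sub>F t in at_right (0::real). 0 < t"
      by (rule eventually_at_right_less)
    ultimately have "\<forall>\<^sub>F t in at_right 0. 0 < t \<and> p + t *\<^sub>R x \<in> cell \<eta> UNIV I (Q \<union> S)"
      by (auto elim: eventually_elim2)
    then show ?thesis
      using eventually_happens trivial_limit_at_right_real by blast
  qed
  have closed: "convex (closed_cell \<eta> I P)" "closed (closed_cell \<eta> I P)" if "P \<subseteq> I" for P
    using polyhedron_closed_cell[OF I that] polyhedron_imp_convex polyhedron_imp_closed by auto
  have "bij_betw (\<lambda>P. P \<inter> K) {P\<in>Pow I. cell \<eta> UNIV I P \<noteq> {} \<and> closest_point (closed_cell \<eta> I P) z = p}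
      {Q\<in>Pow K. in_polar (z - p) (cell \<eta> UNIV K Q)}" (is "bij_betw _ ?A ?B")
  proof (rule bij_betw_byWitness[where f' = "\<lambda>Q. Q \<union> S"])
    have *: "P \<inter> K \<union> S = P" if "P \<in> ?A" for P
    proof -
      have P: "P \<subseteq> I" "closest_point (closed_cell \<eta> I P) z = p" using that by auto
      have "0 \<in> closed_cell \<eta> I P" by (simp add: closed_cell_def)
      then have "p \<in> closed_cell \<eta> I P"
        using closest_point_in_set[of "closed_cell \<eta> I P" z] closed[OF P(1)] P(2) by blast
      then have "i \<in> P \<longleftrightarrow> 0 < \<eta> i \<bullet> p" if "i \<in> I - K" for i
        using pnK[OF that] that by (cases "i \<in> P") (force simp: closed_cell_def)+
      then show ?thesis using P by (auto simp: S_def)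
    qed
    then show "\<forall>P\<in>?A. P \<inter> K \<union> S = P" by blast
    show "\<forall>Q\<in>?B. (Q \<union> S) \<inter> K = Q" using S by auto
    show "(\<lambda>P. P \<inter> K) ` ?A \<subseteq> ?B"
    proof (rule image_subsetI)
      fix P assume "P \<in> ?A"
      then have P: "P \<subseteq> I" "cell \<eta> UNIV I P \<noteq> {}" "p = closest_point (closed_cell \<eta> I P) z"
        by auto
      then have PS: "P \<inter> K \<union> S = P" using * by auto
      obtain y where "y \<in> cell \<eta> UNIV I P" using P by blast
      then have y: "y \<in> cell \<eta> UNIV K (P \<inter> K)" using K by (auto simp: cell_def)
      have "(z - p) \<bullet> x \<le> 0" if x: "x \<in> cell \<eta> UNIV K (P \<inter> K)" for x
      proof -
        obtain t where t: "t > 0" "p + t *\<^sub>R x \<in> cell \<eta> UNIV I P"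
          using move[OF _ x] PS by auto
        then have "p + t *\<^sub>R x \<in> closed_cell \<eta> I P"
          by (auto simp: cell_def closed_cell_def intro: less_imp_le)
        then show ?thesis
          using closest_point_dot[OF closed[OF P(1)], of "p + t *\<^sub>R x" z] t P(3)[symmetric]
          by (simp add: mult_le_0_iff)
      qed
      with y show "P \<inter> K \<in> ?B"
        by (auto simp: in_polar_def)
    qed
    show "(\<lambda>Q. Q \<union> S) ` ?B \<subseteq> ?A"
    proof (rule image_subsetI)
      fix Q assume "Q \<in> ?B"
      then have Q: "Q \<subseteq> K" "in_polar (z - p) (cell \<eta> UNIV K Q)" by auto
      have QS: "Q \<union> S \<subseteq> I" using Q K S by auto
      have ne: "cell \<eta> UNIV I (Q \<union> S) \<noteq> {}"
        using Q move[OF Q(1)] by (force simp: in_polar_def)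
      have pC: "p \<in> closed_cell \<eta> I (Q \<union> S)"
      proof -
        have "0 \<le> \<eta> i \<bullet> p" if "i \<in> Q \<union> S" for i
          using that pK Q by (auto simp: S_def)
        moreover have "\<eta> i \<bullet> p \<le> 0" if "i \<in> I - (Q \<union> S)" for i
          using that pK[of i] by (cases "i \<in> K") (auto simp: S_def)
        ultimately show ?thesis by (simp add: closed_cell_def)
      qed
      have "(z - p) \<bullet> (c - p) \<le> 0" if c: "c \<in> closed_cell \<eta> I (Q \<union> S)" for c
      proof -
        \<comment> \<open>The criterion is checked on the open cell, where \<open>x - p\<close> has
          the strict signs of the localized cell, and then passes to the closure.\<close>
        have "cell \<eta> UNIV I (Q \<union> S) \<subseteq> {x. (z - p) \<bullet> x \<le> (z - p) \<bullet> p}"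
        proof
          fix x assume x: "x \<in> cell \<eta> UNIV I (Q \<union> S)"
          have "x - p \<in> cell \<eta> UNIV K Q"
            using x Q(1) K S pK by (auto simp: cell_def inner_diff_right)
          then have "(z - p) \<bullet> (x - p) \<le> 0" using Q by (auto simp: in_polar_def)
          then show "x \<in> {x. (z - p) \<bullet> x \<le> (z - p) \<bullet> p}" by (simp add: inner_diff_right)
        qed
        then have "closure (cell \<eta> UNIV I (Q \<union> S)) \<subseteq> {x. (z - p) \<bullet> x \<le> (z - p) \<bullet> p}"
          by (intro closure_minimal closed_halfspace_le)
        then show ?thesis
          using c closure_cell[OF I QS ne] by (auto simp: inner_diff_right)
      qed
      then have "closest_point (closed_cell \<eta> I (Q \<union> S)) z = p"
        using closed[OF QS] pC by (intro closest_point_eqI) auto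
      with QS ne show "Q \<union> S \<in> ?A" by auto
    qed
  qed
  then show ?thesis by (rule bij_betw_same_card)
qed

text \<open>In the signed count of cells in a halfspace, genericity leaves only the sets
  \<open>J\<close> with flat \<open>X\<close>. They share the sign given by the dimension, and the
  rest is Whitney's formula.\<close>

lemma card_in_polar_eq_moebius:
  fixes \<eta> :: "'i \<Rightarrow> 'a::euclidean_space"
  assumes I: "finite I" "\<And>i. i \<in> I \<Longrightarrow> \<eta> i \<noteq> 0"
    and z: "generic (flat \<eta> ` Pow I) z" and X: "X \<in> flat \<eta> ` Pow I"
  defines "p \<equiv> closest_point X z" and "K \<equiv> {i\<in>I. \<forall>x\<in>X. \<eta> i \<bullet> x = 0}"
  shows "int (card {Q\<in>Pow K. in_polar (z - p) (cell \<eta> UNIV K Q)})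
    = (-1) ^ (DIM('a) + dim X) * moebius (flat \<eta> ` Pow I) UNIV X"
proof -
  have K: "finite K" "K \<subseteq> I" using I by (auto simp: K_def)
  have subX: "subspace X" using X subspace_flat by auto
  have orth: "(\<forall>x\<in>flat \<eta> J. (z - p) \<bullet> x = 0) \<longleftrightarrow> flat \<eta> J = X" if J: "J \<subseteq> K" for J
  proof
    assume *: "\<forall>x\<in>flat \<eta> J. (z - p) \<bullet> x = 0"
    \<comment> \<open>Orthogonality of \<open>z - p\<close> to this larger flat makes
      \<open>p\<close> its projection too, so genericity applies.\<close>
    have XJ: "X \<subseteq> flat \<eta> J" using J by (auto simp: K_def flat_def)
    have "closest_point (flat \<eta> J) z = p"
      using * XJ closest_point_subspace(1)[OF subX, of z]
      by (intro closest_point_subspace_eqI subspace_flat) (auto simp: p_def)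
    then show "flat \<eta> J = X"
      using genericD[OF z X _ XJ] J K by (auto simp: p_def)
  next
    assume "flat \<eta> J = X"
    then show "\<forall>x\<in>flat \<eta> J. (z - p) \<bullet> x = 0"
      using closest_point_subspace(2)[OF subX] by (simp add: p_def)
  qed
  have "int (card {Q\<in>Pow K. in_polar (z - p) (cell \<eta> UNIV K Q)})
    = (\<Sum>Q\<in>Pow K. of_bool (in_polar (z - p) (cell \<eta> UNIV K Q)))"
    using K by (simp add: Int_def)
  also have "\<dots> = (\<Sum>J\<in>Pow K. (-1) ^ card J * (-1) ^ (DIM('a) + dim (flat \<eta> J))
         * of_bool (\<forall>x\<in>flat \<eta> J. (z - p) \<bullet> x = 0))"
    using card_cells_in_polar[OF K(1) subspace_UNIV, of "z - p" \<eta>] by (simp add: dim_UNIV)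
  also have "\<dots> = (\<Sum>J\<in>Pow K. if flat \<eta> J = X then (-1) ^ (DIM('a) + dim X) * (-1) ^ card J else 0)"
    by (intro sum.cong refl) (auto simp: orth)
  also have "\<dots> = (\<Sum>J\<in>{J\<in>Pow K. flat \<eta> J = X}. (-1) ^ (DIM('a) + dim X) * (-1) ^ card J)"
    using K by (subst sum.inter_filter) auto
  also have "{J\<in>Pow K. flat \<eta> J = X} = {J\<in>Pow I. flat \<eta> J = X}"
    by (auto simp: K_def flat_def)
  finally show ?thesis
    using moebius_flat[OF I X] by (simp add: sum_distrib_left)
qed

text \<open>The crucial point is that the right-hand side does not depend on \<open>z\<close>. After
  faces are replaced by flats, the two sums can be swapped and the regions counted flat by
  flat.\<close>

lemma projection_cone_count:
  fixes \<eta> :: "'i \<Rightarrow> 'a::euclidean_space"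
  assumes I: "finite I" "\<And>i. i \<in> I \<Longrightarrow> \<eta> i \<noteq> 0" and z: "generic (flat \<eta> ` Pow I) z"
  shows "(\<Sum>P\<in>{P\<in>Pow I. cell \<eta> UNIV I P \<noteq> {}}.
      \<Sum>F\<in>{F. F face_of closed_cell \<eta> I P \<and> aff_dim F = int k}.
        indicator (projection_cone (closed_cell \<eta> I P) F) z :: real)
    = real_of_int ((-1) ^ (DIM('a) + k)
        * (\<Sum>X\<in>{X\<in>flat \<eta> ` Pow I. dim X = k}. moebius (flat \<eta> ` Pow I) UNIV X))"
proof -
  let ?A = "{P\<in>Pow I. cell \<eta> UNIV I P \<noteq> {}}" and ?L = "{X\<in>flat \<eta> ` Pow I. dim X = k}"
  have "(\<Sum>P\<in>?A. \<Sum>F\<in>{F. F face_of closed_cell \<eta> I P \<and> aff_dim F = int k}.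
        indicator (projection_cone (closed_cell \<eta> I P) F) z :: real)
    = (\<Sum>P\<in>?A. \<Sum>X\<in>?L. of_bool (closest_point (closed_cell \<eta> I P) z = closest_point X z))"
    using I z by (intro sum.cong sum_faces_projection_cone) auto
  also have "\<dots> = (\<Sum>X\<in>?L. \<Sum>P\<in>?A. of_bool (closest_point (closed_cell \<eta> I P) z = closest_point X z))"
    by (rule sum.swap)
  also have "\<dots> = (\<Sum>X\<in>?L. real_of_int ((-1) ^ (DIM('a) + k) * moebius (flat \<eta> ` Pow I) UNIV X))"
  proof (rule sum.cong)
    fix X assume X: "X \<in> ?L"
    let ?B = "{P\<in>Pow I. cell \<eta> UNIV I P \<noteq> {} \<and> closest_point (closed_cell \<eta> I P) z = closest_point X z}"
    have "?A \<inter> {P. closest_point (closed_cell \<eta> I P) z = closest_point X z} = ?B" by auto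
    then have "(\<Sum>P\<in>?A. of_bool (closest_point (closed_cell \<eta> I P) z = closest_point X z)) = real (card ?B)"
      using I by simp
    also have "\<dots> = real_of_int (int (card ?B))" by simp
    also have "int (card ?B) = (-1) ^ (DIM('a) + k) * moebius (flat \<eta> ` Pow I) UNIV X"
      using X card_in_polar_eq_moebius[OF I z, of X] card_cells_projecting_to_flat[OF I(1) z, of X] by simp
    finally show "(\<Sum>P\<in>?A. of_bool (closest_point (closed_cell \<eta> I P) z = closest_point X z))
      = real_of_int ((-1) ^ (DIM('a) + k) * moebius (flat \<eta> ` Pow I) UNIV X)" .
  qed simp
  also have "\<dots> = real_of_int ((-1) ^ (DIM('a) + k) * (\<Sum>X\<in>?L. moebius (flat \<eta> ` Pow I) UNIV X))"
    by (simp add: sum_distrib_left)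
  finally show ?thesis .
qed

section \<open>From pointwise counts to volumes\<close>

lemma sum_measure_eq_of_constant_multiplicity:
  fixes B :: "'a::euclidean_space set"
  assumes "finite K" "\<And>i. i \<in> K \<Longrightarrow> S i \<in> sets lebesgue" "B \<in> lmeasurable" "negligible N"
    and "\<And>z. z \<notin> N \<Longrightarrow> (\<Sum>i\<in>K. indicator (S i) z :: real) = c"
  shows "(\<Sum>i\<in>K. measure lebesgue (S i \<inter> B)) = c * measure lebesgue B"
proof -
  have m: "S i \<inter> B \<in> lmeasurable" if "i \<in> K" for i
    using assms that fmeasurable_Int_fmeasurable[of B lebesgue "S i"] by (simp add: Int_commute)
  have "(\<Sum>i\<in>K. measure lebesgue (S i \<inter> B)) = (\<Sum>i\<in>K. \<integral>z. indicator (S i \<inter> B) z \<partial>lebesgue)"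
    by (intro sum.cong) (auto)
  also have "\<dots> = (\<integral>z. (\<Sum>i\<in>K. indicator (S i \<inter> B) z) \<partial>lebesgue)"
    using m by (intro Bochner_Integration.integral_sum[symmetric]) (simp add: lmeasurable_iff_integrable)
  also have "\<dots> = (\<integral>z. c * indicator B z \<partial>lebesgue)"
  proof (rule integral_cong_AE)
    have "AE z in lebesgue. z \<notin> N"
      using assms(4) negligible_iff_null_sets AE_not_in by blast
    then show "AE z in lebesgue. (\<Sum>i\<in>K. indicator (S i \<inter> B) z) = c * indicator B z"
    proof eventually_elim
      case (elim z)
      have "(\<Sum>i\<in>K. indicator (S i \<inter> B) z :: real) = (\<Sum>i\<in>K. indicator (S i) z) * indicator B z"
        by (simp add: indicator_inter_arith sum_distrib_right)
      then show ?case using assms(5)[OF elim] by simp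
    qed
  qed (use m assms in \<open>auto intro!: borel_measurable_sum borel_measurable_indicator
      borel_measurable_times borel_measurable_const dest: fmeasurableD\<close>)
  also have "\<dots> = c * measure lebesgue B" by simp
  finally show ?thesis .
qed

text \<open>The relative interior is relatively open in a closed affine subspace, hence Borel, and
  the nearest-point map is continuous.\<close>

lemma projection_cone_in_sets_lebesgue:
  assumes "convex C" "closed C" "C \<noteq> {}"
  shows "projection_cone C F \<in> sets lebesgue"
proof -
  obtain T where T: "open T" "rel_interior F = affine hull F \<inter> T"
    using openin_rel_interior[of F] unfolding openin_open by blast
  have "rel_interior F \<in> sets borel"
    unfolding T(2) using T(1) by (intro sets.Int borel_closed borel_open) auto
  moreover have "closest_point C \<in> borel_measurable borel"
    using continuous_on_closest_point[OF assms] by (rule borel_measurable_continuous_onI)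
  ultimately have "closest_point C -` rel_interior F \<inter> space borel \<in> sets borel"
    by (rule measurable_sets[rotated])
  moreover have "projection_cone C F = closest_point C -` rel_interior F \<inter> space borel"
    by (auto simp: projection_cone_def)
  ultimately show ?thesis by (simp add: sets_completionI_sets)
qed

lemma sum_projection_volume_cells:
  fixes \<eta> :: "'i \<Rightarrow> 'a::euclidean_space"
  assumes I: "finite I" "\<And>i. i \<in> I \<Longrightarrow> \<eta> i \<noteq> 0"
  shows "(\<Sum>P\<in>{P\<in>Pow I. cell \<eta> UNIV I P \<noteq> {}}. projection_volume k (closed_cell \<eta> I P))
    = real_of_int \<bar>\<Sum>X\<in>{X\<in>flat \<eta> ` Pow I. dim X = k}. moebius (flat \<eta> ` Pow I) UNIV X\<bar>"
proof -
  let ?A = "{P\<in>Pow I. cell \<eta> UNIV I P \<noteq> {}}"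
  let ?G = "\<lambda>P. {F. F face_of closed_cell \<eta> I P \<and> aff_dim F = int k}"
  let ?M = "\<Sum>X\<in>{X\<in>flat \<eta> ` Pow I. dim X = k}. moebius (flat \<eta> ` Pow I) UNIV X"
  define c where "c = real_of_int ((-1) ^ (DIM('a) + k) * ?M)"
  define B where "B = cball (0::'a) 1"
  define N where "N = {z. \<not> generic (flat \<eta> ` Pow I) z}"
  have poly: "polyhedron (closed_cell \<eta> I P)" if "P \<in> ?A" for P
    using that I by (intro polyhedron_closed_cell) auto
  have fin: "finite (?G P)" if "P \<in> ?A" for P
    using finite_subset[OF _ finite_polyhedron_faces[OF poly[OF that]]] by simp
  have N: "negligible N"
    unfolding N_def using I by (intro negligible_not_generic) (auto simp: subspace_flat)
  have count: "(\<Sum>(P, F)\<in>Sigma ?A ?G. indicator (projection_cone (closed_cell \<eta> I P) F) z :: real) = c"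
    if "z \<notin> N" for z
    using that projection_cone_count[OF I, where z = z and k = k] fin I
    by (subst sum.Sigma[symmetric]) (auto simp: N_def c_def)
  have B: "measure lebesgue B > 0" unfolding B_def by (simp add: content_cball_pos)
  have "(\<Sum>P\<in>?A. projection_volume k (closed_cell \<eta> I P))
    = (\<Sum>(P, F)\<in>Sigma ?A ?G. measure lebesgue (projection_cone (closed_cell \<eta> I P) F \<inter> B)) / measure lebesgue B"
    using fin I unfolding projection_volume_def face_volume_def B_def
    by (subst sum.Sigma[symmetric]) (auto simp: sum_divide_distrib)
  also have "(\<Sum>(P, F)\<in>Sigma ?A ?G. measure lebesgue (projection_cone (closed_cell \<eta> I P) F \<inter> B))
    = c * measure lebesgue B"
    unfolding case_prod_beta
  proof (rule sum_measure_eq_of_constant_multiplicity[OF _ _ _ N])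
    show "finite (Sigma ?A ?G)" using fin I by (intro finite_SigmaI) auto
    show "B \<in> lmeasurable" by (simp add: B_def)
    show "(\<Sum>i\<in>Sigma ?A ?G. indicator (projection_cone (closed_cell \<eta> I (fst i)) (snd i)) z :: real) = c"
      if "z \<notin> N" for z
      using count[OF that] by (simp add: case_prod_beta)
    fix i assume "i \<in> Sigma ?A ?G"
    then have "fst i \<in> ?A" by (cases i) (simp only: mem_Sigma_iff fst_conv)
    then have "polyhedron (closed_cell \<eta> I (fst i))" by (rule poly)
    moreover have "0 \<in> closed_cell \<eta> I (fst i)" by (simp add: closed_cell_def)
    ultimately show "projection_cone (closed_cell \<eta> I (fst i)) (snd i) \<in> sets lebesgue"
      by (intro projection_cone_in_sets_lebesgue polyhedron_imp_convex polyhedron_imp_closed) auto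
  qed
  also have "c * measure lebesgue B / measure lebesgue B = c" using B by simp
  finally have eq: "(\<Sum>P\<in>?A. projection_volume k (closed_cell \<eta> I P)) = c" .
  \<comment> \<open>Being a sum of volumes, \<open>c\<close> is nonnegative. This fixes the sign
    without a separate proof that the Moebius function alternates.\<close>
  have "0 \<le> c"
    unfolding eq[symmetric] projection_volume_def face_volume_def by (intro sum_nonneg) auto
  then have "c = \<bar>c\<bar>" by simp
  also have "\<dots> = real_of_int \<bar>?M\<bar>" by (simp add: c_def abs_mult power_abs)
  finally show ?thesis using eq by simp
qed

section \<open>Coefficients of the characteristic polynomial\<close>

text \<open>Every flat contains the common intersection, which is the orthogonal complement of the
  span of the normals. The bound makes the truncated subtraction in the exponents exact.\<close>

lemma codim_flat_le:
  fixes \<eta> :: "'i \<Rightarrow> 'a::euclidean_space"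
  assumes "X \<in> flat \<eta> ` Pow I"
  shows "DIM('a) \<le> dim (\<eta> ` I) + dim X"
proof -
  have "flat \<eta> I = {y\<in>UNIV. \<forall>x\<in>span (\<eta> ` I). orthogonal x y}"
  proof (intro set_eqI iffI)
    fix y assume "y \<in> flat \<eta> I"
    then have "\<And>x. x \<in> \<eta> ` I \<Longrightarrow> orthogonal y x"
      by (auto simp: flat_def orthogonal_def inner_commute)
    then show "y \<in> {y\<in>UNIV. \<forall>x\<in>span (\<eta> ` I). orthogonal x y}"
      using orthogonal_to_span orthogonal_commute by blast
  next
    fix y assume "y \<in> {y\<in>UNIV. \<forall>x\<in>span (\<eta> ` I). orthogonal x y}"
    then show "y \<in> flat \<eta> I"
      by (auto simp: flat_def orthogonal_def span_base)
  qed
  then have "dim (flat \<eta> I) + dim (\<eta> ` I) = DIM('a)"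
    using dim_subspace_orthogonal_to_vectors[of "span (\<eta> ` I)" UNIV] by (simp add: dim_UNIV)
  moreover have "dim (flat \<eta> I) \<le> dim X"
    using assms by (intro dim_subset) (auto simp: flat_def)
  ultimately show ?thesis by simp
qed

lemma coeff_characteristic_polynomial:
  fixes \<eta> :: "'i \<Rightarrow> 'a::euclidean_space"
  assumes I: "finite I" and r: "r = dim (\<eta> ` I)"
  shows "int_coeff (characteristic_polynomial r ((\<lambda>i. central_hyperplane (\<eta> i)) ` I))
      (int r - int DIM('a) + int k)
    = (\<Sum>X\<in>{X\<in>flat \<eta> ` Pow I. dim X = k}. moebius (flat \<eta> ` Pow I) UNIV X)"
proof -
  let ?L = "flat \<eta> ` Pow I"
  have le: "DIM('a) \<le> r + dim X" if "X \<in> ?L" for X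
    using codim_flat_le[OF that] r by simp
  show ?thesis
  proof (cases "DIM('a) \<le> r + k")
    case True
    have "(\<Sum>X\<in>?L. coeff (monom (moebius ?L UNIV X) (r - (DIM('a) - dim X))) (r + k - DIM('a)))
      = (\<Sum>X\<in>?L. if dim X = k then moebius ?L UNIV X else 0)"
    proof (rule sum.cong)
      fix X assume X: "X \<in> ?L"
      have "dim X \<le> DIM('a)" by (rule dim_subset_UNIV)
      then have "r - (DIM('a) - dim X) = r + k - DIM('a) \<longleftrightarrow> dim X = k"
        using le[OF X] True by linarith
      then show "coeff (monom (moebius ?L UNIV X) (r - (DIM('a) - dim X))) (r + k - DIM('a))
          = (if dim X = k then moebius ?L UNIV X else 0)"
        by simp
    qed simp
    also have "\<dots> = (\<Sum>X\<in>{X\<in>?L. dim X = k}. moebius ?L UNIV X)"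
      using I by (subst sum.inter_filter) auto
    moreover have "nat (int r - int DIM('a) + int k) = r + k - DIM('a)" using True by linarith
    ultimately show ?thesis
      using True
      by (simp add: int_coeff_def characteristic_polynomial_def intersection_lattice_eq coeff_sum)
  next
    \<comment> \<open>The exponent is negative and the coefficient is 0 by convention. No flat has
      dimension \<open>k\<close>, as its codimension would exceed the rank, so the sum is
      empty.\<close>
    case False
    then have "{X\<in>?L. dim X = k} = {}" using le by fastforce
    moreover have "int r - int DIM('a) + int k < 0" using False by linarith
    ultimately show ?thesis by (simp only: int_coeff_def) simp
  qed
qed

theorem theorem5:
  fixes \<eta> :: "nat \<Rightarrow> real ^ 'd" and m r :: nat
    and \<A> :: "(real ^ 'd) set set"
  assumes "\<forall>i\<in>{1..m}. \<eta> i \<noteq> 0"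
    and "\<A> = (\<lambda>i. central_hyperplane (\<eta> i)) ` {1..m}"
    and "r = dim (span (\<eta> ` {1..m}))"
  shows "\<forall>k::nat. (\<Sum>R\<in>regions \<A>. projection_volume k (closure R))
           = real_of_int \<bar>int_coeff (characteristic_polynomial r \<A>) (int r - int CARD('d) + int k)\<bar>"
proof
  fix k :: nat
  let ?I = "{1..m}"
  have "(\<Sum>R\<in>regions \<A>. projection_volume k (closure R))
    = (\<Sum>P\<in>{P\<in>Pow ?I. cell \<eta> UNIV ?I P \<noteq> {}}. projection_volume k (closure (cell \<eta> UNIV ?I P)))"
    unfolding assms(2) regions_eq_cells[OF finite_atLeastAtMost]
    by (simp only: sum.reindex[OF inj_on_cell] comp_def)
  also have "\<dots> = (\<Sum>P\<in>{P\<in>Pow ?I. cell \<eta> UNIV ?I P \<noteq> {}}. projection_volume k (closed_cell \<eta> ?I P))"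
    by (intro sum.cong refl arg_cong[where f = "projection_volume k"] closure_cell) auto
  also have "\<dots> = real_of_int \<bar>\<Sum>X\<in>{X\<in>flat \<eta> ` Pow ?I. dim X = k}. moebius (flat \<eta> ` Pow ?I) UNIV X\<bar>"
    using assms(1) by (intro sum_projection_volume_cells) auto
  also have "\<dots> = real_of_int \<bar>int_coeff (characteristic_polynomial r \<A>) (int r - int CARD('d) + int k)\<bar>"
    using coeff_characteristic_polynomial[of ?I r \<eta> k] assms(2,3) by simp
  finally show "(\<Sum>R\<in>regions \<A>. projection_volume k (closure R))
    = real_of_int \<bar>int_coeff (characteristic_polynomial r \<A>) (int r - int CARD('d) + int k)\<bar>" .
qed

end
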